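(* Let $n\ge 2$ be an integer with a partition $n=\sum_{k=1}^{\tau} n_k$, where $n_k\ge 1$ are integers and $n_k\ge m_k:=\sum_{i=k+1}^{\tau} n_i$ for all $k\in[\tau-1]$. Let $A_{\mathrm{DSHB}}\in\mathbb{R}^{n\times n}$ be the matrix generated by the DSHB factorization algorithm (described in the context), with scaled HB sequence $\{\widetilde A^{(k)}\}_{k=1}^{\tau}$. Then $A_{\mathrm{DSHB}}$ is doubly stochastic, hierarchically banded, and satisfies $$J=J_0A_{\mathrm{DSHB}}J_0.$$ Each matrix in the scaled HB sequence $\{\widetilde A^{(k)}\}_{k=1}^{\tau}$ is doubly stochastic. In addition, $$\operatorname{nnz}(A_{\mathrm{DSHB}})=\sum_{k=1}^{\tau}k\,n_k,\qquad d_{\max}(A_{\mathrm{DSHB}})=\tau.$$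
   Context: Notation: $[r]=\{1,\ldots,r\}$. $\mathbf{1}_r$ is the all-ones column vector in $\mathbb{R}^r$ and $I_r$ is the $r\times r$ identity. $J=\frac1n\mathbf{1}_n\mathbf{1}_n^{\mathsf T}$, $J_k=\frac1{n_k}\mathbf{1}_{n_k}\mathbf{1}_{n_k}^{\mathsf T}\in\mathbb{R}^{n_k\times n_k}$, and $J_0=J_1\oplus\cdots\oplus J_\tau$, where $\oplus$ is the direct sum (block diagonal matrix). Put $m_0:=n$ (so $m_{\tau-1}=n_\tau$). A square matrix $A$ is doubly stochastic if all its entries are nonnegative, $A\mathbf 1=\mathbf 1$ and $A^{\mathsf T}\mathbf 1=\mathbf 1$, where $\mathbf 1$ is the all-ones vector of compatible size. $\operatorname{nnz}(A)$ is the number of nonzero entries of $A$, and $d_{\max}(A)=\max_i \operatorname{nnz}(A_{i,:})$, where $A_{i,:}$ is the $i$th row. Hierarchically banded (HB) matrices: given the partition of $n$, a real symmetric $n\times n$ matrix $A$ is hierarchically banded if there are symmetric matrices $A^{(k)}\in\mathbb{R}^{m_{k-1}\times m_{k-1}}$, $k\in[\tau]$ (the HB sequence of $A$), such that $A^{(1)}=A$, $A^{(\tau)}$ is a diagonal $n_\tau\times n_\tau$ matrix, and for all $k\in[\tau-1]$ $$A^{(k)}=\begin{bmatrix}A^{(k)}_{11}&A^{(k)}_{12}\\ (A^{(k)}_{12})^{\mathsf T}&A^{(k)}_{22}\end{bmatrix},$$ where $A^{(k)}_{11}$ is an $n_k\times n_k$ diagonal matrix, $A^{(k)}_{12}\in\mathbb{R}^{n_k\times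 m_k}$ has nonzero entries only on its diagonal (positions $[j,j]$), and $A^{(k)}_{22}=A^{(k+1)}$. DSHB (doubly stochastic hierarchically banded) factorization algorithm: given the partition, it constructs matrices $\widetilde A^{(k)}\in\mathbb{R}^{m_{k-1}\times m_{k-1}}$, $k\in[\tau]$ (the scaled HB sequence), recursively: $\widetilde A^{(\tau)}=I_{n_\tau}$, and for $k\in[\tau-1]$ $$\widetilde A^{(k)}=\begin{bmatrix}\widetilde A^{(k)}_{11}&\widetilde A^{(k)}_{12}\\ (\widetilde A^{(k)}_{12})^{\mathsf T}&\widetilde A^{(k)}_{22}\end{bmatrix},\qquad \widetilde A^{(k)}_{22}=\tfrac{m_k}{m_{k-1}}\widetilde A^{(k+1)},$$ where $\widetilde A^{(k)}_{11}=\operatorname{diag}\big(\underbrace{\tfrac{m_k}{m_{k-1}},\ldots,\tfrac{m_k}{m_{k-1}}}_{m_k},\underbrace{1,\ldots,1}_{n_k-m_k}\big)\in\mathbb{R}^{n_k\times n_k}$ and $\widetilde A^{(k)}_{12}\in\mathbb{R}^{n_k\times m_k}$ has entries $\widetilde A^{(k)}_{12}[i,j]=\frac{n_k}{m_{k-1}}$ if $i=j\in\{1,\ldots,m_k\}$ and $0$ otherwise. The output is $A_{\mathrm{DSHB}}:=\widetilde A^{(1)}$, with associated HB sequence $A^{(k)}=\frac{m_{k-1}}{n}\widetilde A^{(k)}$, $k\in[\tau]$.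
   Formalization: The printed nnz(A_DSHB) = Σ k·n_k fails for n=2, n_1=n_2=1 (4 nonzero entries, formula gives 3); proved instead: nnz(A_DSHB) = Σ (2k−1)·n_k, and Σ k·n_k is the number of nonzero entries on or above the diagonal. *)

theory Defs
  imports Complex_Main "Jordan_Normal_Form.Matrix"
begin

text \<open>
  A partition \<open>n = n\<^sub>1 + \<dots> + n\<^sub>\<tau>\<close> is given by a function \<open>\<nu>\<close> and the number \<open>\<tau>\<close> of parts, with
  \<open>n\<^sub>k = \<nu> k\<close> for \<open>k \<in> {1..\<tau>}\<close>; values of \<open>\<nu>\<close> outside this range are irrelevant.
  Parts keep their 1-based numbering, whereas matrix entries are indexed from 0 as in the library.
\<close>

definition tail_sum :: "(nat \<Rightarrow> nat) \<Rightarrow> nat \<Rightarrow> nat \<Rightarrow> nat" where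
  "tail_sum \<nu> \<tau> k = (\<Sum>i=k+1..\<tau>. \<nu> i)"

definition is_partition :: "nat \<Rightarrow> (nat \<Rightarrow> nat) \<Rightarrow> nat \<Rightarrow> bool" where
  "is_partition n \<nu> \<tau> \<longleftrightarrow> n = (\<Sum>k=1..\<tau>. \<nu> k) \<and> (\<forall>k\<in>{1..\<tau>}. \<nu> k \<ge> 1)"

definition ones_vec :: "nat \<Rightarrow> real vec" where
  "ones_vec r = vec r (\<lambda>_. 1)"

definition avg_mat :: "nat \<Rightarrow> real mat" where
  "avg_mat r = (1 / real r) \<cdot>\<^sub>m mat r r (\<lambda>_. 1)"

definition block_avg_mat :: "(nat \<Rightarrow> nat) \<Rightarrow> nat \<Rightarrow> real mat" where
  "block_avg_mat \<nu> \<tau> = diag_block_mat (map (\<lambda>k. avg_mat (\<nu> k)) [1..<\<tau> + 1])"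

definition doubly_stochastic :: "real mat \<Rightarrow> bool" where
  "doubly_stochastic A \<longleftrightarrow>
     square_mat A \<and>
     (\<forall>i<dim_row A. \<forall>j<dim_col A. A $$ (i, j) \<ge> 0) \<and>
     A *\<^sub>v ones_vec (dim_col A) = ones_vec (dim_row A) \<and>
     transpose_mat A *\<^sub>v ones_vec (dim_row A) = ones_vec (dim_col A)"

definition nnz :: "real mat \<Rightarrow> nat" where
  "nnz A = card {(i, j). i < dim_row A \<and> j < dim_col A \<and> A $$ (i, j) \<noteq> 0}"

text \<open>
  Nonzero entries on or above the diagonal. For a symmetric matrix this is the number of
  entries to be stored, each pair \<open>(i, j)\<close>, \<open>(j, i)\<close> being counted once. It is needed in
  addition to \<open>nnz\<close> because the formula \<open>n\<^sub>1 + 2 n\<^sub>2 + \<dots> + \<tau> n\<^sub>\<tau>\<close> given in the literature for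
  \<open>nnz\<close> of the DSHB matrix is the value of this count; for \<open>\<tau> \<ge> 2\<close> it is smaller than \<open>nnz\<close>.
\<close>

definition nnz_upper :: "real mat \<Rightarrow> nat" where
  "nnz_upper A = card {(i, j). i < dim_row A \<and> j < dim_col A \<and> i \<le> j \<and> A $$ (i, j) \<noteq> 0}"

definition d_max :: "real mat \<Rightarrow> nat" where
  "d_max A = Max ((\<lambda>i. card {j. j < dim_col A \<and> A $$ (i, j) \<noteq> 0}) ` {..<dim_row A})"

text \<open>
  With \<open>m\<^sub>0 = n\<close>, the \<open>k\<close>-th matrix has size \<open>m\<^sub>k\<^sub>-\<^sub>1 = n\<^sub>k + m\<^sub>k\<close>. The library predicate
  \<open>diagonal_mat\<close> also covers the rectangular block \<open>A12\<close>.
\<close>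

definition is_HB_sequence :: "(nat \<Rightarrow> nat) \<Rightarrow> nat \<Rightarrow> real mat \<Rightarrow> (nat \<Rightarrow> real mat) \<Rightarrow> bool" where
  "is_HB_sequence \<nu> \<tau> A S \<longleftrightarrow>
     (\<forall>k\<in>{1..\<tau>}. S k \<in> carrier_mat (tail_sum \<nu> \<tau> (k - 1)) (tail_sum \<nu> \<tau> (k - 1)) \<and>
                  transpose_mat (S k) = S k) \<and>
     S 1 = A \<and>
     diagonal_mat (S \<tau>) \<and>
     (\<forall>k\<in>{1..<\<tau>}. \<exists>A11 A12.
        A11 \<in> carrier_mat (\<nu> k) (\<nu> k) \<and> diagonal_mat A11 \<and>
        A12 \<in> carrier_mat (\<nu> k) (tail_sum \<nu> \<tau> k) \<and> diagonal_mat A12 \<and>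
        S k = four_block_mat A11 A12 (transpose_mat A12) (S (k + 1)))"

definition hierarchically_banded :: "nat \<Rightarrow> (nat \<Rightarrow> nat) \<Rightarrow> nat \<Rightarrow> real mat \<Rightarrow> bool" where
  "hierarchically_banded n \<nu> \<tau> A \<longleftrightarrow>
     A \<in> carrier_mat n n \<and> transpose_mat A = A \<and> (\<exists>S. is_HB_sequence \<nu> \<tau> A S)"

definition dshb_11 :: "(nat \<Rightarrow> nat) \<Rightarrow> nat \<Rightarrow> nat \<Rightarrow> real mat" where
  "dshb_11 \<nu> \<tau> k = mat_diag (\<nu> k)
     (\<lambda>i. if i < tail_sum \<nu> \<tau> k
          then real (tail_sum \<nu> \<tau> k) / real (tail_sum \<nu> \<tau> (k - 1)) else 1)"

definition dshb_12 :: "(nat \<Rightarrow> nat) \<Rightarrow> nat \<Rightarrow> nat \<Rightarrow> real mat" where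
  "dshb_12 \<nu> \<tau> k = mat (\<nu> k) (tail_sum \<nu> \<tau> k)
     (\<lambda>(i, j). if i = j then real (\<nu> k) / real (tail_sum \<nu> \<tau> (k - 1)) else 0)"

text \<open>The scaled HB sequence; only the indices \<open>k \<in> {1..\<tau>}\<close> are meaningful.\<close>

function scaled_HB :: "(nat \<Rightarrow> nat) \<Rightarrow> nat \<Rightarrow> nat \<Rightarrow> real mat" where
  "scaled_HB \<nu> \<tau> k =
     (if k < \<tau> then
        four_block_mat (dshb_11 \<nu> \<tau> k) (dshb_12 \<nu> \<tau> k) (transpose_mat (dshb_12 \<nu> \<tau> k))
          ((real (tail_sum \<nu> \<tau> k) / real (tail_sum \<nu> \<tau> (k - 1))) \<cdot>\<^sub>m scaled_HB \<nu> \<tau> (k + 1))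
      else 1\<^sub>m (\<nu> \<tau>))"
  by pat_completeness auto
termination
  by (relation "measure (\<lambda>(\<nu>, \<tau>, k). \<tau> - k)") auto

declare scaled_HB.simps [simp del]

definition A_DSHB :: "(nat \<Rightarrow> nat) \<Rightarrow> nat \<Rightarrow> real mat" where
  "A_DSHB \<nu> \<tau> = scaled_HB \<nu> \<tau> 1"

end

theory Submission
  imports Defs
begin

text \<open>
  Everything follows by downward induction on \<open>k\<close> from
  \<open>m\<^sub>k\<^sub>-\<^sub>1 = n\<^sub>k + m\<^sub>k\<close>. In the identity \<open>J = J\<^sub>0 A J\<^sub>0\<close> the upper left block is the
  only one that needs a computation: the diagonal of \<open>A11\<close> has sum
  \<open>m\<^sub>k\<^sup>2 / m\<^sub>k\<^sub>-\<^sub>1 + (n\<^sub>k - m\<^sub>k) = n\<^sub>k\<^sup>2 / m\<^sub>k\<^sub>-\<^sub>1\<close>. The off-diagonal block \<open>A12\<close>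
  has constant column sums, and all-ones matrices absorb averaging. For the nonzero counts,
  \<open>n\<^sub>k \<ge> m\<^sub>k\<close> ensures that \<open>A12\<close> has exactly one nonzero entry in each column, so that
  each step adds one nonzero entry to every row of the trailing block.
\<close>

section \<open>Sums and symmetric stochastic matrices\<close>

lemma sum_lessThan_add:
  fixes f :: "nat \<Rightarrow> 'a::comm_monoid_add"
  shows "sum f {..<a + b} = sum f {..<a} + (\<Sum>i<b. f (a + i))"
  by (induction b) (simp_all add: add.assoc)

lemma sum_lessThan_delta:
  fixes f :: "nat \<Rightarrow> 'a::comm_monoid_add"
  shows "(\<Sum>j<c. if i = j then f j else 0) = (if i < c then f i else 0)"
  by (subst sum.delta') auto

lemma transpose_smult_mat: "transpose_mat (c \<cdot>\<^sub>m A) = c \<cdot>\<^sub>m transpose_mat A"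
  by (intro eq_matI) auto

text \<open>Symmetry turns row sums into column sums, so one family of sums settles both
  stochasticity conditions.\<close>

lemma doubly_stochastic_symI:
  assumes "A \<in> carrier_mat r r" "transpose_mat A = A"
    and "\<And>i j. i < r \<Longrightarrow> j < r \<Longrightarrow> 0 \<le> A $$ (i, j)"
    and "\<And>i. i < r \<Longrightarrow> (\<Sum>j<r. A $$ (i, j)) = 1"
  shows "doubly_stochastic A"
proof -
  have "A *\<^sub>v ones_vec r = ones_vec r"
    using assms by (intro eq_vecI)
      (auto simp: ones_vec_def scalar_prod_def atLeast0LessThan)
  then show ?thesis
    using assms by (auto simp: doubly_stochastic_def)
qed

lemma doubly_stochastic_row_sum:
  assumes "doubly_stochastic A" "A \<in> carrier_mat r r" "i < r"
  shows "(\<Sum>j<r. A $$ (i, j)) = 1"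
proof -
  have "(A *\<^sub>v ones_vec r) $ i = ones_vec r $ i"
    using assms by (auto simp: doubly_stochastic_def)
  then show ?thesis
    using assms by (auto simp: ones_vec_def scalar_prod_def atLeast0LessThan)
qed

section \<open>Counting nonzero entries\<close>

text \<open>Counting by a sum of \<open>of_bool\<close> instead of a cardinality lets
  \<open>sum_lessThan_add\<close> split the count along block boundaries.\<close>

definition row_nnz :: "real mat \<Rightarrow> nat \<Rightarrow> nat" where
  "row_nnz A i = (\<Sum>j<dim_col A. of_bool (A $$ (i, j) \<noteq> 0))"

lemma card_Collect_less:
  "card {j. j < (r::nat) \<and> P j} = (\<Sum>j<r. of_bool (P j))"
proof -
  have "{j. j < r \<and> P j} = {..<r} \<inter> {j. P j}" by auto
  then show ?thesis by (simp add: sum_of_bool_eq)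
qed

lemma card_Collect_less2:
  "card {(i, j). i < (r::nat) \<and> j < (c::nat) \<and> P i j} = (\<Sum>i<r. \<Sum>j<c. of_bool (P i j))"
proof -
  have "{(i, j). i < r \<and> j < c \<and> P i j} = (SIGMA i:{..<r}. {j. j < c \<and> P i j})" by auto
  then show ?thesis by (simp add: card_SigmaI card_Collect_less)
qed

lemma nnz_eq_sum: "nnz A = (\<Sum>i<dim_row A. row_nnz A i)"
  by (simp add: nnz_def row_nnz_def card_Collect_less2)

lemma nnz_upper_eq_sum:
  "nnz_upper A = (\<Sum>i<dim_row A. \<Sum>j<dim_col A. of_bool (i \<le> j \<and> A $$ (i, j) \<noteq> 0))"
  by (simp add: nnz_upper_def card_Collect_less2)

lemma d_max_eqI:
  assumes "\<And>i. i < dim_row A \<Longrightarrow> row_nnz A i \<le> d"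
    and "i < dim_row A" "row_nnz A i = d"
  shows "d_max A = d"
  unfolding d_max_def card_Collect_less
  by (rule Max_eqI) (use assms in \<open>auto simp: row_nnz_def\<close>)

lemma row_nnz_smult:
  assumes "c \<noteq> 0" "i < dim_row A"
  shows "row_nnz (c \<cdot>\<^sub>m A) i = row_nnz A i"
  using assms by (auto simp: row_nnz_def)

lemma nnz_smult: "c \<noteq> 0 \<Longrightarrow> nnz (c \<cdot>\<^sub>m A) = nnz A"
  by (simp add: nnz_eq_sum row_nnz_smult)

lemma nnz_upper_smult: "c \<noteq> 0 \<Longrightarrow> nnz_upper (c \<cdot>\<^sub>m A) = nnz_upper A"
  by (simp add: nnz_upper_eq_sum)

text \<open>Stronger than \<open>diagonal_mat\<close>: zeros on the diagonal are excluded too, also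
  for rectangular matrices, so every count depends on the dimensions alone.\<close>

definition full_diagonal :: "real mat \<Rightarrow> bool" where
  "full_diagonal A \<longleftrightarrow> (\<forall>i<dim_row A. \<forall>j<dim_col A. A $$ (i, j) \<noteq> 0 \<longleftrightarrow> i = j)"

lemma one_mat_full_diagonal: "full_diagonal (1\<^sub>m r)"
  by (auto simp: full_diagonal_def)

lemma row_nnz_full_diagonal:
  assumes "full_diagonal A" "i < dim_row A"
  shows "row_nnz A i = of_bool (i < dim_col A)"
proof -
  have "row_nnz A i = (\<Sum>j<dim_col A. if i = j then 1 else 0)"
    unfolding row_nnz_def using assms by (intro sum.cong) (auto simp: full_diagonal_def)
  then show ?thesis by (simp add: sum_lessThan_delta)
qed

lemma nnz_full_diagonal:
  assumes "full_diagonal A"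
  shows "nnz A = min (dim_row A) (dim_col A)"
proof -
  have "nnz A = card {i. i < dim_row A \<and> i < dim_col A}"
    using assms by (simp add: nnz_eq_sum row_nnz_full_diagonal card_Collect_less)
  also have "{i. i < dim_row A \<and> i < dim_col A} = {..<min (dim_row A) (dim_col A)}" by auto
  finally show ?thesis by simp
qed

lemma nnz_upper_full_diagonal:
  assumes "full_diagonal A"
  shows "nnz_upper A = nnz A"
proof -
  have "{(i, j). i < dim_row A \<and> j < dim_col A \<and> i \<le> j \<and> A $$ (i, j) \<noteq> 0} =
        {(i, j). i < dim_row A \<and> j < dim_col A \<and> A $$ (i, j) \<noteq> 0}"
    using assms by (auto simp: full_diagonal_def)
  then show ?thesis by (simp add: nnz_def nnz_upper_def)
qed

lemma row_nnz_four_block_mat: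
  assumes "A \<in> carrier_mat a b" "B \<in> carrier_mat a d" "C \<in> carrier_mat c b" "D \<in> carrier_mat c d"
  shows "i < a \<Longrightarrow> row_nnz (four_block_mat A B C D) i = row_nnz A i + row_nnz B i"
    and "i < c \<Longrightarrow> row_nnz (four_block_mat A B C D) (a + i) = row_nnz C i + row_nnz D i"
  using assms by (auto simp: row_nnz_def sum_lessThan_add)

lemma nnz_four_block_mat:
  assumes "A \<in> carrier_mat a b" "B \<in> carrier_mat a d" "C \<in> carrier_mat c b" "D \<in> carrier_mat c d"
  shows "nnz (four_block_mat A B C D) = nnz A + nnz B + nnz C + nnz D"
proof -
  have "nnz (four_block_mat A B C D) =
      (\<Sum>i<a. row_nnz A i + row_nnz B i) + (\<Sum>i<c. row_nnz C i + row_nnz D i)"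
    using assms row_nnz_four_block_mat[OF assms] by (simp add: nnz_eq_sum sum_lessThan_add)
  then show ?thesis using assms by (simp add: nnz_eq_sum sum.distrib)
qed

text \<open>All columns of \<open>B\<close> come after the first \<open>a\<close> rows, so
  \<open>B\<close> counts in full, and by the same reason \<open>C\<close> not at all. Rows and
  columns of \<open>D\<close> are shifted by the same \<open>a\<close>, which preserves their
  order.\<close>

lemma nnz_upper_four_block_mat:
  assumes "A \<in> carrier_mat a a" "B \<in> carrier_mat a d" "C \<in> carrier_mat d a" "D \<in> carrier_mat d d"
  shows "nnz_upper (four_block_mat A B C D) = nnz_upper A + nnz B + nnz_upper D"
  using assms
  by (simp add: nnz_upper_eq_sum nnz_eq_sum row_nnz_def sum_lessThan_add sum.distrib
      del: sum_of_bool_eq)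

section \<open>Averaging matrices\<close>

lemma avg_mat_carrier [simp]: "avg_mat r \<in> carrier_mat r r"
  by (simp add: avg_mat_def)

lemma avg_mat_index [simp]: "i < r \<Longrightarrow> j < r \<Longrightarrow> avg_mat r $$ (i, j) = 1 / real r"
  by (simp add: avg_mat_def)

lemma dim_avg_mat [simp]: "dim_row (avg_mat r) = r" "dim_col (avg_mat r) = r"
  by (simp_all add: avg_mat_def)

lemma avg_mat_mult:
  assumes "A \<in> carrier_mat r c"
  shows "avg_mat r * A = mat r c (\<lambda>(i, j). (\<Sum>l<r. A $$ (l, j)) / real r)"
  using assms by (intro eq_matI)
    (auto simp: scalar_prod_def atLeast0LessThan sum_divide_distrib)

lemma mult_avg_mat:
  assumes "A \<in> carrier_mat r c"
  shows "A * avg_mat c = mat r c (\<lambda>(i, j). (\<Sum>l<c. A $$ (i, l)) / real c)"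
  using assms by (intro eq_matI)
    (auto simp: scalar_prod_def atLeast0LessThan sum_divide_distrib)

text \<open>Each row of the constant matrix is a multiple of the all-ones row, which
  \<open>P\<close> fixes when its columns sum to one.\<close>

lemma const_mult:
  assumes "P \<in> carrier_mat r r" "\<And>j. j < r \<Longrightarrow> (\<Sum>i<r. P $$ (i, j)) = (1::real)"
  shows "mat q r (\<lambda>_. x) * P = mat q r (\<lambda>_. x)"
  using assms by (intro eq_matI)
    (auto simp: scalar_prod_def atLeast0LessThan sum_distrib_left[symmetric])

text \<open>The direct sum of J_k, ..., J_\<tau>: the part of J_0 that acts on level k. At k = 1 it
  is \<open>block_avg_mat\<close>.\<close>

abbreviation tail_avg_mat :: "(nat \<Rightarrow> nat) \<Rightarrow> nat \<Rightarrow> nat \<Rightarrow> real mat" where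
  "tail_avg_mat \<nu> \<tau> k \<equiv> diag_block_mat (map (\<lambda>k. avg_mat (\<nu> k)) [k..<\<tau> + 1])"

lemma tail_avg_mat_last: "tail_avg_mat \<nu> \<tau> \<tau> = avg_mat (\<nu> \<tau>)"
  \<comment> \<open>\<open>diag_block_mat\<close> of a single block still appends an empty 0 x 0
    block, hence the entrywise comparison.\<close>
  by (intro eq_matI) (auto simp: Let_def)

lemma tail_avg_mat_step:
  assumes "k < \<tau>" "tail_avg_mat \<nu> \<tau> (Suc k) \<in> carrier_mat r r"
  shows "tail_avg_mat \<nu> \<tau> k = four_block_mat (avg_mat (\<nu> k)) (0\<^sub>m (\<nu> k) r) (0\<^sub>m r (\<nu> k))
    (tail_avg_mat \<nu> \<tau> (Suc k))"
proof -
  \<comment> \<open>\<open>diag_block_mat\<close> recurses on the head of the list, whereas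
    \<open>upt_Suc\<close> would split off its last element; hence its deletion here and
    later.\<close>
  have "[k..<\<tau> + 1] = k # [Suc k..<\<tau> + 1]"
    using assms(1) by (simp add: upt_conv_Cons del: upt_Suc)
  then show ?thesis
    using assms(2) by (auto simp: Let_def simp del: upt_Suc)
qed

section \<open>The DSHB recursion\<close>

text \<open>The total n appears only as \<open>tail_sum \<nu> \<tau> 0\<close>, the size at k = 1,
  so that all levels are treated uniformly.\<close>

locale dominated_partition =
  fixes \<nu> :: "nat \<Rightarrow> nat" and \<tau> :: nat
  assumes parts: "\<tau> \<ge> 1"
    and pos: "k \<in> {1..\<tau>} \<Longrightarrow> \<nu> k \<ge> 1"
    and dom: "k \<in> {1..\<tau> - 1} \<Longrightarrow> \<nu> k \<ge> tail_sum \<nu> \<tau> k"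
begin

declare One_nat_def [simp del] \<comment> \<open>otherwise \<open>m (k - 1)\<close> is rewritten to \<open>m (k - Suc 0)\<close> and no longer matches the rules below\<close>

abbreviation m :: "nat \<Rightarrow> nat" where "m \<equiv> tail_sum \<nu> \<tau>"

abbreviation S :: "nat \<Rightarrow> real mat" where "S \<equiv> scaled_HB \<nu> \<tau>"

section \<open>Tail sums and the blocks of the recursion\<close>

lemma m_rec:
  assumes "1 \<le> k" "k \<le> \<tau>"
  shows "m (k - 1) = \<nu> k + m k"
  using assms by (cases k) (simp_all add: tail_sum_def sum.atLeast_Suc_atMost flip: Suc_eq_plus1)

lemma m_last [simp]: "m \<tau> = 0"
  by (simp add: tail_sum_def)

lemma m_pos: "k < \<tau> \<Longrightarrow> m k > 0"
  using m_rec[of "Suc k"] pos[of "Suc k"] by simp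

lemma S_last: "S \<tau> = 1\<^sub>m (\<nu> \<tau>)"
  by (simp add: scaled_HB.simps)

lemma S_step:
  assumes "k < \<tau>"
  shows "S k = four_block_mat (dshb_11 \<nu> \<tau> k) (dshb_12 \<nu> \<tau> k)
    (transpose_mat (dshb_12 \<nu> \<tau> k)) ((real (m k) / real (m (k - 1))) \<cdot>\<^sub>m S (Suc k))"
  using assms by (subst scaled_HB.simps) (simp add: Suc_eq_plus1)

lemma dshb_carrier [simp]:
  "dshb_11 \<nu> \<tau> k \<in> carrier_mat (\<nu> k) (\<nu> k)"
  "dshb_12 \<nu> \<tau> k \<in> carrier_mat (\<nu> k) (m k)"
  "transpose_mat (dshb_12 \<nu> \<tau> k) \<in> carrier_mat (m k) (\<nu> k)"
  by (simp_all add: dshb_11_def dshb_12_def)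

lemma dim_dshb [simp]:
  "dim_row (dshb_11 \<nu> \<tau> k) = \<nu> k" "dim_col (dshb_11 \<nu> \<tau> k) = \<nu> k"
  "dim_row (dshb_12 \<nu> \<tau> k) = \<nu> k" "dim_col (dshb_12 \<nu> \<tau> k) = m k"
  by (simp_all add: dshb_11_def dshb_12_def mat_diag_def)

lemma dshb_11_index:
  "i < \<nu> k \<Longrightarrow> j < \<nu> k \<Longrightarrow> dshb_11 \<nu> \<tau> k $$ (i, j) =
    (if i = j then if i < m k then real (m k) / real (m (k - 1)) else 1 else 0)"
  by (simp add: dshb_11_def mat_diag_def)

lemma dshb_12_index:
  "i < \<nu> k \<Longrightarrow> j < m k \<Longrightarrow> dshb_12 \<nu> \<tau> k $$ (i, j) =
    (if i = j then real (\<nu> k) / real (m (k - 1)) else 0)"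
  by (simp add: dshb_12_def)

text \<open>For k < \<tau> both m_k and m_(k-1) are positive, so none of the quotients on the
  diagonals vanishes.\<close>

lemma dshb_full_diagonal:
  assumes "1 \<le> k" "k < \<tau>"
  shows "full_diagonal (dshb_11 \<nu> \<tau> k)" "full_diagonal (dshb_12 \<nu> \<tau> k)"
    "full_diagonal (transpose_mat (dshb_12 \<nu> \<tau> k))"
  using m_pos[of k] m_pos[of "k - 1"] assms
  by (auto simp: full_diagonal_def dshb_11_index dshb_12_index)

section \<open>Size, symmetry and double stochasticity of the scaled sequence\<close>

lemma S_carrier:
  assumes "1 \<le> k" "k \<le> \<tau>"
  shows "S k \<in> carrier_mat (m (k - 1)) (m (k - 1))"
  \<comment> \<open>\<open>inc_induct\<close> consumes the first fact,
    \<open>k \<le> \<tau>\<close>, and descends from \<tau>; \<open>1 \<le> k\<close> remains a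
    premise of the induction.\<close>
  using assms(2,1)
proof (induction k rule: inc_induct)
  case base
  then show ?case by (simp add: S_last m_rec)
next
  case (step k)
  then have "(real (m k) / real (m (k - 1))) \<cdot>\<^sub>m S (Suc k) \<in> carrier_mat (m k) (m k)" by simp
  from four_block_carrier_mat[OF dshb_carrier(1) this] show ?case
    using step by (simp add: S_step m_rec)
qed

lemma S_22_carrier:
  assumes "1 \<le> k" "k < \<tau>"
  shows "c \<cdot>\<^sub>m S (Suc k) \<in> carrier_mat (m k) (m k)"
  using S_carrier[of "Suc k"] assms by simp

lemma S_symmetric:
  assumes "1 \<le> k" "k \<le> \<tau>"
  shows "transpose_mat (S k) = S k"
  using assms(2,1)
proof (induction k rule: inc_induct)
  case base
  then show ?case by (simp add: S_last)
next
  case (step k)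
  have 11: "transpose_mat (dshb_11 \<nu> \<tau> k) = dshb_11 \<nu> \<tau> k"
    by (intro eq_matI) (auto simp: dshb_11_index)
  have 22: "transpose_mat (c \<cdot>\<^sub>m S (Suc k)) = c \<cdot>\<^sub>m S (Suc k)" for c
    using step by (simp add: transpose_smult_mat)
  show ?case
    using step
    by (simp add: S_step 11 22
        transpose_four_block_mat[OF dshb_carrier(1,2,3) S_22_carrier])
qed

text \<open>Every row that meets A12 or its transpose gets n_k / m_(k-1) from there and m_k /
  m_(k-1) from the diagonal block, where the lower rows use the induction hypothesis. These add up
  to 1.\<close>

lemma S_doubly_stochastic:
  assumes "1 \<le> k" "k \<le> \<tau>"
  shows "doubly_stochastic (S k)"
  using assms(2,1)
proof (induction k rule: inc_induct)
  case base
  show ?case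
    by (rule doubly_stochastic_symI[of _ "\<nu> \<tau>"])
      (auto simp: S_last sum_lessThan_delta[where f = "\<lambda>_. 1"])
next
  case (step k)
  define c where "c = real (m k) / real (m (k - 1))"
  have mk: "m (k - 1) = \<nu> k + m k" and le: "m k \<le> \<nu> k" and "m k > 0"
    using step m_rec[of k] dom[of k] m_pos[of k] by auto
  then have cs: "c + real (\<nu> k) / real (m (k - 1)) = 1"
    unfolding c_def mk by (simp add: add_divide_distrib[symmetric])
  have DS: "doubly_stochastic (S (Suc k))" using step by simp
  have car: "S (Suc k) \<in> carrier_mat (m k) (m k)" using S_carrier[of "Suc k"] step by simp
  show ?case
  proof (rule doubly_stochastic_symI[OF S_carrier S_symmetric])
    fix i j assume ij: "i < m (k - 1)" "j < m (k - 1)"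
    have nonneg: "S (Suc k) $$ (i', j') \<ge> 0" if "i' < m k" "j' < m k" for i' j'
      using DS car that by (auto simp: doubly_stochastic_def)
    show "0 \<le> S k $$ (i, j)"
      using ij step car by (auto simp: S_step mk dshb_11_index dshb_12_index nonneg)
  next
    fix i assume i: "i < m (k - 1)"
    show "(\<Sum>j<m (k - 1). S k $$ (i, j)) = 1"
    proof (cases "i < \<nu> k")
      case True
      then have "(\<Sum>j<m (k - 1). S k $$ (i, j)) =
          (\<Sum>j<\<nu> k. if i = j then if j < m k then c else 1 else 0) +
          (\<Sum>j<m k. if i = j then real (\<nu> k) / real (m (k - 1)) else 0)"
        unfolding mk sum_lessThan_add using step car
        by (auto simp: S_step dshb_11_index dshb_12_index c_def mk intro!: arg_cong2[where f = plus] sum.cong)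
      \<comment> \<open>For i < m_k the two sums are \<open>c\<close> and n_k / m_(k-1); from m_k on
        they are 1 and 0.\<close>
      also have "\<dots> = 1"
        using True cs by (simp add: sum_lessThan_delta)
      finally show ?thesis .
    next
      case False
      then obtain l where l: "i = \<nu> k + l" "l < m k"
        using i mk by (metis add_less_cancel_left le_Suc_ex not_le)
      then have "(\<Sum>j<m (k - 1). S k $$ (i, j)) =
          (\<Sum>j<\<nu> k. if l = j then real (\<nu> k) / real (m (k - 1)) else 0) +
          (\<Sum>j<m k. c * S (Suc k) $$ (l, j))"
        unfolding mk sum_lessThan_add using step car
        by (auto simp: S_step dshb_12_index c_def mk intro!: arg_cong2[where f = plus] sum.cong)
      also have "(\<Sum>j<m k. c * S (Suc k) $$ (l, j)) = c"
        using doubly_stochastic_row_sum[OF DS car l(2)] by (simp add: sum_distrib_left[symmetric])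
      \<comment> \<open>Row \<open>l\<close> of the transposed A12 has its entry in column
        \<open>l\<close>, which lies inside the block because
        \<open>m k \<le> \<nu> k\<close>.\<close>
      finally show ?thesis
        using l le cs by (simp add: sum_lessThan_delta)
    qed
  qed (use step in auto)
qed

section \<open>Hierarchical bandedness\<close>

lemma S_hierarchically_banded:
  "hierarchically_banded (m 0) \<nu> \<tau> (S 1)"
proof -
  \<comment> \<open>The witness undoes the scaling: m_(k-1) / n times m_k / m_(k-1) is m_k / n, so
    the trailing block of \<open>T k\<close> is exactly \<open>T (k + 1)\<close>.\<close>
  define T where "T k = (real (m (k - 1)) / real (m 0)) \<cdot>\<^sub>m S k" for k
  have m0: "m 0 > 0" using m_pos[of 0] parts by simp
  have T1: "T 1 = S 1"
    using m0 by (intro eq_matI) (auto simp: T_def)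
  have carT: "T k \<in> carrier_mat (m (k - 1)) (m (k - 1))" if "1 \<le> k" "k \<le> \<tau>" for k
    using S_carrier[OF that] by (simp add: T_def)
  have symT: "transpose_mat (T k) = T k" if "1 \<le> k" "k \<le> \<tau>" for k
    using S_symmetric[OF that] by (simp add: T_def transpose_smult_mat)
  have diagT: "diagonal_mat (T \<tau>)"
    by (auto simp: T_def S_last diagonal_mat_def)
  have stepT: "\<exists>A11 A12.
        A11 \<in> carrier_mat (\<nu> k) (\<nu> k) \<and> diagonal_mat A11 \<and>
        A12 \<in> carrier_mat (\<nu> k) (m k) \<and> diagonal_mat A12 \<and>
        T k = four_block_mat A11 A12 (transpose_mat A12) (T (k + 1))"
    if k: "1 \<le> k" "k < \<tau>" for k
  proof (intro exI conjI)
    define c where "c = real (m (k - 1)) / real (m 0)"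
    have mk: "m (k - 1) = \<nu> k + m k" and "m (k - 1) > 0" using k m_rec[of k] m_pos[of "k - 1"] by auto
    then show "T k = four_block_mat (c \<cdot>\<^sub>m dshb_11 \<nu> \<tau> k) (c \<cdot>\<^sub>m dshb_12 \<nu> \<tau> k)
        (transpose_mat (c \<cdot>\<^sub>m dshb_12 \<nu> \<tau> k)) (T (k + 1))"
      using k carT[of k] carT[of "Suc k"] S_carrier[of "Suc k"] m0
      by (intro eq_matI) (auto simp: T_def S_step c_def simp flip: Suc_eq_plus1)
    show "diagonal_mat (c \<cdot>\<^sub>m dshb_11 \<nu> \<tau> k)" "diagonal_mat (c \<cdot>\<^sub>m dshb_12 \<nu> \<tau> k)"
      by (auto simp: diagonal_mat_def dshb_11_index dshb_12_index)
  qed simp_all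
  have "is_HB_sequence \<nu> \<tau> (S 1) T"
    unfolding is_HB_sequence_def using T1 carT symT diagT stepT by auto
  then show ?thesis
    unfolding hierarchically_banded_def
    using S_carrier[of 1] S_symmetric[of 1] parts by auto
qed

section \<open>The averaging identity\<close>

lemma tail_avg_mat_carrier:
  assumes "1 \<le> k" "k \<le> \<tau>"
  shows "tail_avg_mat \<nu> \<tau> k \<in> carrier_mat (m (k - 1)) (m (k - 1))"
  using assms(2,1)
proof (induction k rule: inc_induct)
  case base
  then show ?case by (simp add: tail_avg_mat_last m_rec del: upt_Suc)
next
  case (step k)
  then have P: "tail_avg_mat \<nu> \<tau> (Suc k) \<in> carrier_mat (m k) (m k)" by simp
  show ?case
    using step tail_avg_mat_step[OF _ P] four_block_carrier_mat[OF avg_mat_carrier P]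
    by (simp add: m_rec del: upt_Suc)
qed

lemma tail_avg_mat_col_sum:
  assumes "1 \<le> k" "k \<le> \<tau>" "j < m (k - 1)"
  shows "(\<Sum>i<m (k - 1). tail_avg_mat \<nu> \<tau> k $$ (i, j)) = 1"
  using assms(2,1,3)
proof (induction k arbitrary: j rule: inc_induct)
  case base
  then show ?case using pos[of \<tau>] by (simp add: tail_avg_mat_last m_rec del: upt_Suc)
next
  case (step k)
  then have P: "tail_avg_mat \<nu> \<tau> (Suc k) \<in> carrier_mat (m k) (m k)"
    using tail_avg_mat_carrier[of "Suc k"] by simp
  have mk: "m (k - 1) = \<nu> k + m k" and "\<nu> k > 0" using step m_rec[of k] pos[of k] by auto
  then show ?case
    using step.prems P step.IH[of "j - \<nu> k"] unfolding tail_avg_mat_step[OF step.hyps(2) P]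
    by (cases "j < \<nu> k") (auto simp: sum_lessThan_add simp del: upt_Suc cong: sum.cong_simp)
qed

lemma tail_avg_mat_symmetric:
  assumes "1 \<le> k" "k \<le> \<tau>"
  shows "transpose_mat (tail_avg_mat \<nu> \<tau> k) = tail_avg_mat \<nu> \<tau> k"
  using assms(2,1)
proof (induction k rule: inc_induct)
  case base
  show ?case unfolding tail_avg_mat_last by (intro eq_matI) auto
next
  case (step k)
  then have P: "tail_avg_mat \<nu> \<tau> (Suc k) \<in> carrier_mat (m k) (m k)"
    using tail_avg_mat_carrier[of "Suc k"] by simp
  have J: "transpose_mat (avg_mat (\<nu> k)) = avg_mat (\<nu> k)" by (intro eq_matI) auto
  show ?case
    unfolding tail_avg_mat_step[OF step.hyps(2) P]
      transpose_four_block_mat[OF avg_mat_carrier zero_carrier_mat zero_carrier_mat P]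
    using step by (simp add: J del: upt_Suc)
qed

text \<open>Averaging on both sides replaces each entry by the mean of all entries, here the total
  n_k^2 / m_(k-1) over n_k^2 positions.\<close>

lemma avg_dshb_11_avg:
  assumes "1 \<le> k" "k < \<tau>"
  shows "avg_mat (\<nu> k) * dshb_11 \<nu> \<tau> k * avg_mat (\<nu> k) = mat (\<nu> k) (\<nu> k) (\<lambda>_. 1 / real (m (k - 1)))"
proof -
  define c where "c = real (m k) / real (m (k - 1))"
  have mk: "m (k - 1) = \<nu> k + m k" and le: "m k \<le> \<nu> k" and nu: "\<nu> k > 0"
    using assms m_rec[of k] dom[of k] pos[of k] by auto
  have col: "(\<Sum>l<\<nu> k. dshb_11 \<nu> \<tau> k $$ (l, j)) = (if j < m k then c else 1)" if "j < \<nu> k" for j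
  proof -
    have "(\<Sum>l<\<nu> k. dshb_11 \<nu> \<tau> k $$ (l, j)) = (\<Sum>l<\<nu> k. if j = l then if l < m k then c else 1 else 0)"
      using that by (intro sum.cong) (auto simp: dshb_11_index c_def)
    then show ?thesis using that by (simp add: sum_lessThan_delta)
  qed
  \<comment> \<open>Writing n_k - m_k as \<open>d\<close> avoids truncated subtraction.\<close>
  obtain d where d: "\<nu> k = m k + d" using le le_Suc_ex by blast
  have "(\<Sum>j<\<nu> k. if j < m k then c else 1) = real (m k) * c + real d"
    unfolding d sum_lessThan_add by simp
  \<comment> \<open>As m_(k-1) = 2 m_k + d, this is m_k^2 + d (2 m_k + d) = (m_k + d)^2.\<close>
  moreover have "(real (m k) * c + real d) * real (m (k - 1)) = real (\<nu> k) * real (\<nu> k)"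
  proof -
    have "c * real (m (k - 1)) = real (m k)" using nu mk by (simp add: c_def)
    then have "(real (m k) * c + real d) * real (m (k - 1)) =
        real (m k) * real (m k) + real d * real (m (k - 1))"
      by (simp add: distrib_right mult.assoc)
    then show ?thesis unfolding mk d by (simp add: algebra_simps)
  qed
  ultimately have total: "(\<Sum>j<\<nu> k. if j < m k then c else 1) = real (\<nu> k) * real (\<nu> k) / real (m (k - 1))"
    using nu mk by (simp add: eq_divide_eq)
  have "avg_mat (\<nu> k) * dshb_11 \<nu> \<tau> k = mat (\<nu> k) (\<nu> k) (\<lambda>(i, j). (if j < m k then c else 1) / real (\<nu> k))"
    using col by (subst avg_mat_mult[OF dshb_carrier(1)]) (auto intro!: cong_mat)
  then show ?thesis
    using nu total by (auto simp: mult_avg_mat[OF mat_carrier] sum_divide_distrib[symmetric] intro!: cong_mat)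
qed

text \<open>One factor suffices: since m_k <= n_k, every column reaches its diagonal position and
  has sum n_k / m_(k-1). The result is constant, so a further averaging factor on the right is
  absorbed by \<open>const_mult\<close>.\<close>

lemma avg_dshb_12:
  assumes "1 \<le> k" "k < \<tau>"
  shows "avg_mat (\<nu> k) * dshb_12 \<nu> \<tau> k = mat (\<nu> k) (m k) (\<lambda>_. 1 / real (m (k - 1)))"
proof -
  have le: "m k \<le> \<nu> k" and nu: "\<nu> k > 0"
    using assms dom[of k] pos[of k] by auto
  have "(\<Sum>l<\<nu> k. dshb_12 \<nu> \<tau> k $$ (l, j)) = real (\<nu> k) / real (m (k - 1))" if "j < m k" for j
  proof -
    have "(\<Sum>l<\<nu> k. dshb_12 \<nu> \<tau> k $$ (l, j)) = (\<Sum>l<\<nu> k. if j = l then real (\<nu> k) / real (m (k - 1)) else 0)"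
      using that by (intro sum.cong) (auto simp: dshb_12_index)
    then show ?thesis using that le by (simp add: sum_lessThan_delta)
  qed
  then show ?thesis
    using nu by (subst avg_mat_mult[OF dshb_carrier(2)]) (auto intro!: cong_mat)
qed

lemma avg_mat_factorization:
  assumes "1 \<le> k" "k \<le> \<tau>"
  shows "tail_avg_mat \<nu> \<tau> k * S k * tail_avg_mat \<nu> \<tau> k = avg_mat (m (k - 1))"
  using assms(2,1)
proof (induction k rule: inc_induct)
  case base
  \<comment> \<open>Here the middle factor is the identity, and the claim is that averaging is
    idempotent.\<close>
  then show ?case
    using pos[of \<tau>] unfolding tail_avg_mat_last S_last right_mult_one_mat[OF avg_mat_carrier]
    by (subst mult_avg_mat[OF avg_mat_carrier]) (auto simp: m_rec intro!: eq_matI)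
next
  case (step k)
  define P where "P = tail_avg_mat \<nu> \<tau> (Suc k)"
  define c where "c = real (m k) / real (m (k - 1))"
  let ?J = "avg_mat (\<nu> k)" and ?A = "dshb_11 \<nu> \<tau> k" and ?B = "dshb_12 \<nu> \<tau> k"
  let ?x = "1 / real (m (k - 1))"
  have mk: "m (k - 1) = \<nu> k + m k" using step m_rec[of k] by simp
  have P: "P \<in> carrier_mat (m k) (m k)"
    using tail_avg_mat_carrier[of "Suc k"] step by (simp add: P_def)
  have Pk: "tail_avg_mat \<nu> \<tau> k = four_block_mat ?J (0\<^sub>m (\<nu> k) (m k)) (0\<^sub>m (m k) (\<nu> k)) P"
    using tail_avg_mat_step[OF step.hyps(2)] P unfolding P_def by blast
  have Pt: "transpose_mat P = P"
    unfolding P_def using tail_avg_mat_symmetric[of "Suc k"] step by simp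
  have Jt: "transpose_mat ?J = ?J" by (intro eq_matI) auto
  have D: "c \<cdot>\<^sub>m S (Suc k) \<in> carrier_mat (m k) (m k)"
    using S_22_carrier step by simp
  have S: "S (Suc k) \<in> carrier_mat (m k) (m k)"
    using S_carrier[of "Suc k"] step by simp
  have 11: "?J * ?A * ?J = mat (\<nu> k) (\<nu> k) (\<lambda>_. ?x)"
    using avg_dshb_11_avg step by simp
  have 12: "?J * ?B * P = mat (\<nu> k) (m k) (\<lambda>_. ?x)"
    unfolding avg_dshb_12[OF step.prems step.hyps(2)]
    by (rule const_mult[OF P])
      (use tail_avg_mat_col_sum[of "Suc k"] step.hyps in \<open>simp add: P_def del: upt_Suc\<close>)
  \<comment> \<open>The lower left block is the transpose of the upper right one, as
    \<open>P\<close> and \<open>?J\<close> are symmetric.\<close>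
  have "P * transpose_mat ?B * ?J = transpose_mat (?J * ?B * P)"
  proof -
    have "transpose_mat (?J * ?B * P) = P * (transpose_mat ?B * ?J)"
      by (simp add: transpose_mult[OF mult_carrier_mat[OF avg_mat_carrier dshb_carrier(2)] P]
          transpose_mult[OF avg_mat_carrier dshb_carrier(2)] Pt Jt)
    then show ?thesis by (simp add: assoc_mult_mat[OF P dshb_carrier(3) avg_mat_carrier])
  qed
  then have 21: "P * transpose_mat ?B * ?J = mat (m k) (\<nu> k) (\<lambda>_. ?x)"
    unfolding 12 by (auto intro!: eq_matI)
  have "P * (c \<cdot>\<^sub>m S (Suc k)) * P = c \<cdot>\<^sub>m (P * S (Suc k) * P)"
    by (simp add: mult_smult_distrib[OF P S] mult_smult_assoc_mat[OF mult_carrier_mat[OF P S] P])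
  also have "P * S (Suc k) * P = avg_mat (m k)"
    using step unfolding P_def by simp
  \<comment> \<open>The scale \<open>c\<close> turns the entries 1 / m_k of the smaller averaging
    matrix into 1 / m_(k-1).\<close>
  finally have 22: "P * (c \<cdot>\<^sub>m S (Suc k)) * P = mat (m k) (m k) (\<lambda>_. ?x)"
    by (auto simp: c_def intro!: eq_matI)
  have PS: "tail_avg_mat \<nu> \<tau> k * S k =
      four_block_mat (?J * ?A) (?J * ?B) (P * transpose_mat ?B) (P * (c \<cdot>\<^sub>m S (Suc k)))"
    unfolding Pk S_step[OF step.hyps(2)] c_def[symmetric]
    by (subst mult_four_block_mat[OF avg_mat_carrier zero_carrier_mat zero_carrier_mat P
            dshb_carrier(1,2,3) D])
      (use P D mult_carrier_mat[OF avg_mat_carrier dshb_carrier(1), of k]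
          mult_carrier_mat[OF avg_mat_carrier dshb_carrier(2), of k]
          left_mult_zero_mat[OF D, of "\<nu> k"] in simp_all)
  have "tail_avg_mat \<nu> \<tau> k * S k * tail_avg_mat \<nu> \<tau> k =
      four_block_mat (?J * ?A * ?J) (?J * ?B * P) (P * transpose_mat ?B * ?J)
        (P * (c \<cdot>\<^sub>m S (Suc k)) * P)"
    unfolding PS unfolding Pk
    by (subst mult_four_block_mat[OF mult_carrier_mat[OF avg_mat_carrier dshb_carrier(1)]
            mult_carrier_mat[OF avg_mat_carrier dshb_carrier(2)]
            mult_carrier_mat[OF P dshb_carrier(3)] mult_carrier_mat[OF P D]
            avg_mat_carrier zero_carrier_mat zero_carrier_mat P])
      (use P D right_mult_zero_mat[OF mult_carrier_mat[OF P D], of "\<nu> k"] in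
        \<open>simp_all add: 11 12 21\<close>)
  then show ?case
    unfolding 11 12 21 22 by (auto simp: mk intro!: eq_matI)
qed

section \<open>Nonzero counts\<close>

lemma scale_nonzero: "1 \<le> k \<Longrightarrow> k < \<tau> \<Longrightarrow> real (m k) / real (m (k - 1)) \<noteq> 0"
  using m_pos[of k] m_pos[of "k - 1"] by simp

text \<open>A row attaining the bound is carried through the induction: every lower row gains one
  entry from the transposed A12, so a fullest row of the next level stays fullest after the shift by
  n_k.\<close>

lemma S_row_nnz:
  assumes "1 \<le> k" "k \<le> \<tau>"
  shows "(\<forall>i<m (k - 1). row_nnz (S k) i \<le> Suc \<tau> - k) \<and>
    (\<exists>i<m (k - 1). row_nnz (S k) i = Suc \<tau> - k)"
  using assms(2,1)
proof (induction k rule: inc_induct)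
  case base
  then show ?case
    using pos[of \<tau>] m_rec[of \<tau>]
    by (auto simp: S_last row_nnz_full_diagonal[OF one_mat_full_diagonal] intro!: exI[of _ 0])
next
  case (step k)
  have mk: "m (k - 1) = \<nu> k + m k" and le: "m k \<le> \<nu> k"
    using step m_rec[of k] dom[of k] by auto
  have D: "(real (m k) / real (m (k - 1))) \<cdot>\<^sub>m S (Suc k) \<in> carrier_mat (m k) (m k)"
    using S_22_carrier step by simp
  note fd = dshb_full_diagonal[OF step.prems step.hyps(2)]
  note rows = row_nnz_four_block_mat[OF dshb_carrier(1,2,3) D, folded S_step[OF step.hyps(2)]]
  have top: "row_nnz (S k) i \<le> 2" if "i < \<nu> k" for i
    using that by (simp add: rows row_nnz_full_diagonal[OF fd(1)] row_nnz_full_diagonal[OF fd(2)])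
  have bot: "row_nnz (S k) (\<nu> k + i) = Suc (row_nnz (S (Suc k)) i)" if "i < m k" for i
    using that le S_carrier[of "Suc k"] step
      row_nnz_smult[OF scale_nonzero[OF step.prems step.hyps(2)], of i "S (Suc k)"]
    by (simp add: rows row_nnz_full_diagonal[OF fd(3)])
  have IH: "\<forall>i<m k. row_nnz (S (Suc k)) i \<le> \<tau> - k" "\<exists>i<m k. row_nnz (S (Suc k)) i = \<tau> - k"
    using step by auto
  show ?case
  proof
    show "\<forall>i<m (k - 1). row_nnz (S k) i \<le> Suc \<tau> - k"
    proof (intro allI impI)
      fix i assume i: "i < m (k - 1)"
      show "row_nnz (S k) i \<le> Suc \<tau> - k"
      proof (cases "i < \<nu> k")
        case True
        \<comment> \<open>Two entries are within the bound since k < \<tau>.\<close>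
        then show ?thesis using top[of i] step.hyps by linarith
      next
        case False
        then show ?thesis using bot[of "i - \<nu> k"] IH(1) i mk step.hyps
          by (simp add: Suc_diff_le less_diff_conv2)
      qed
    qed
    from IH(2) obtain i where "i < m k" "row_nnz (S (Suc k)) i = \<tau> - k" by blast
    then show "\<exists>i<m (k - 1). row_nnz (S k) i = Suc \<tau> - k"
      using bot[of i] mk step.hyps by (intro exI[of _ "\<nu> k + i"]) (simp add: Suc_diff_le)
  qed
qed

text \<open>Passing from k to k + 1 lowers each weight by one, which removes one copy of every part
  from k to \<tau>, in total m_(k-1).\<close>

lemma sum_m_rec:
  assumes "1 \<le> k" "k < \<tau>"
  shows "(\<Sum>i=k..\<tau>. (Suc i - k) * \<nu> i) = m (k - 1) + (\<Sum>i=Suc k..\<tau>. (Suc i - Suc k) * \<nu> i)"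
proof -
  have "(\<Sum>i=k..\<tau>. (Suc i - k) * \<nu> i) = \<nu> k + (\<Sum>i=Suc k..\<tau>. \<nu> i + (Suc i - Suc k) * \<nu> i)"
    using assms by (simp add: sum.atLeast_Suc_atMost Suc_diff_le)
  then show ?thesis
    using assms by (simp add: sum.distrib m_rec) (simp add: tail_sum_def flip: Suc_eq_plus1)
qed

text \<open>Each level adds n_k entries from A11 and m_k from A12, so part i is counted once for
  every level from k to i.\<close>

lemma S_nnz_upper:
  assumes "1 \<le> k" "k \<le> \<tau>"
  shows "nnz_upper (S k) = (\<Sum>i=k..\<tau>. (Suc i - k) * \<nu> i)"
  using assms(2,1)
proof (induction k rule: inc_induct)
  case base
  show ?case
    by (simp add: S_last nnz_upper_full_diagonal nnz_full_diagonal one_mat_full_diagonal)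
next
  case (step k)
  have mk: "m (k - 1) = \<nu> k + m k" and le: "m k \<le> \<nu> k"
    using step m_rec[of k] dom[of k] by auto
  note fd = dshb_full_diagonal[OF step.prems step.hyps(2)]
  have "nnz_upper (S k) = \<nu> k + m k + nnz_upper (S (Suc k))"
    unfolding S_step[OF step.hyps(2)]
      nnz_upper_four_block_mat[OF dshb_carrier(1,2,3) S_22_carrier[OF step.prems step.hyps(2)]]
      nnz_upper_smult[OF scale_nonzero[OF step.prems step.hyps(2)]]
    using le by (simp add: nnz_upper_full_diagonal fd nnz_full_diagonal)
  then show ?case
    using step by (simp only: sum_m_rec mk)
qed

text \<open>The diagonal is free of zeros, so doubling the upper count counts exactly the m_(k-1)
  diagonal entries once too often. This turns the weights k of the upper count into 2k - 1.\<close>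

lemma S_nnz:
  assumes "1 \<le> k" "k \<le> \<tau>"
  shows "nnz (S k) + m (k - 1) = 2 * nnz_upper (S k)"
  using assms(2,1)
proof (induction k rule: inc_induct)
  case base
  then show ?case
    by (simp add: S_last nnz_upper_full_diagonal nnz_full_diagonal one_mat_full_diagonal m_rec)
next
  case (step k)
  have mk: "m (k - 1) = \<nu> k + m k" and le: "m k \<le> \<nu> k"
    using step m_rec[of k] dom[of k] by auto
  note fd = dshb_full_diagonal[OF step.prems step.hyps(2)]
  show ?case
    unfolding S_step[OF step.hyps(2)]
      nnz_upper_four_block_mat[OF dshb_carrier(1,2,3) S_22_carrier[OF step.prems step.hyps(2)]]
      nnz_four_block_mat[OF dshb_carrier(1,2,3) S_22_carrier[OF step.prems step.hyps(2)]]
      nnz_upper_smult[OF scale_nonzero[OF step.prems step.hyps(2)]]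
      nnz_smult[OF scale_nonzero[OF step.prems step.hyps(2)]]
    using le step mk by (simp add: nnz_upper_full_diagonal fd nnz_full_diagonal)
qed

end

theorem theorem2:
  fixes n \<tau> :: nat and \<nu> :: "nat \<Rightarrow> nat"
  assumes "n \<ge> 2"
    and "is_partition n \<nu> \<tau>"
    and "\<And>k. k \<in> {1..\<tau> - 1} \<Longrightarrow> \<nu> k \<ge> tail_sum \<nu> \<tau> k"
  shows "A_DSHB \<nu> \<tau> \<in> carrier_mat n n
    \<and> doubly_stochastic (A_DSHB \<nu> \<tau>)
    \<and> hierarchically_banded n \<nu> \<tau> (A_DSHB \<nu> \<tau>)
    \<and> avg_mat n = block_avg_mat \<nu> \<tau> * A_DSHB \<nu> \<tau> * block_avg_mat \<nu> \<tau>
    \<and> (\<forall>k\<in>{1..\<tau>}. scaled_HB \<nu> \<tau> k \<in> carrier_mat (tail_sum \<nu> \<tau> (k - 1)) (tail_sum \<nu> \<tau> (k - 1))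
          \<and> doubly_stochastic (scaled_HB \<nu> \<tau> k))
    \<and> nnz_upper (A_DSHB \<nu> \<tau>) = (\<Sum>k=1..\<tau>. k * \<nu> k)
    \<and> nnz (A_DSHB \<nu> \<tau>) = (\<Sum>k=1..\<tau>. (2 * k - 1) * \<nu> k)
    \<and> d_max (A_DSHB \<nu> \<tau>) = \<tau>"
proof -
  have n: "n = tail_sum \<nu> \<tau> 0"
    using assms(2) by (simp add: is_partition_def tail_sum_def)
  \<comment> \<open>An empty partition would force n = 0.\<close>
  have \<tau>: "\<tau> \<ge> 1"
    using assms(1) n by (cases \<tau>) (auto simp: tail_sum_def)
  interpret dominated_partition \<nu> \<tau>
    using assms \<tau> by unfold_locales (auto simp: is_partition_def)
  have car: "S 1 \<in> carrier_mat n n"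
    using S_carrier[of 1] \<tau> n by simp
  have upper: "nnz_upper (S 1) = (\<Sum>k=1..\<tau>. k * \<nu> k)"
    using S_nnz_upper[of 1] \<tau> by simp
  have "nnz (S 1) + (\<Sum>k=1..\<tau>. \<nu> k) = 2 * (\<Sum>k=1..\<tau>. k * \<nu> k)"
    using S_nnz[of 1] \<tau> unfolding upper by (simp add: tail_sum_def)
  \<comment> \<open>Summands start at k = 1, so the natural number \<open>2 * k - 1\<close> is not
    truncated.\<close>
  also have "\<dots> = (\<Sum>k=1..\<tau>. (2 * k - 1) * \<nu> k) + (\<Sum>k=1..\<tau>. \<nu> k)"
    unfolding sum.distrib[symmetric] sum_distrib_left
    by (intro sum.cong) (auto simp: diff_mult_distrib)
  finally have nnz: "nnz (S 1) = (\<Sum>k=1..\<tau>. (2 * k - 1) * \<nu> k)" by simp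
  have dmax: "d_max (S 1) = \<tau>"
    using S_row_nnz[of 1] \<tau> car n by (auto intro: d_max_eqI)
  show ?thesis
    unfolding A_DSHB_def block_avg_mat_def
    using car S_carrier S_doubly_stochastic S_hierarchically_banded avg_mat_factorization[of 1]
      upper nnz dmax \<tau> n by auto
qed

end
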